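(* The following three statements hold. (1) Legendre's conjecture is true (that is, $\pi((n+1)^2) - \pi(n^2) \geq 1$ for all natural numbers $n \geq 1$) if and only if $\phi_T(n^2, 2n, \pi(n)) \leq \pi(2n) - \pi(n)$ for all natural numbers $n \geq 1$. (2) For each fixed natural number $n \geq 1$, if $\phi_T(n^2, 2n, \pi(n)) \leq 1$, then $\pi((n+1)^2) - \pi(n^2) \geq 1$. (3) If $\phi_T(n^2, 2n, \pi(n))$ is bounded above as a function of $n$ (that is, there is a constant $C$ with $\phi_T(n^2, 2n, \pi(n)) \leq C$ for all $n \geq 1$), then $\pi((n+1)^2) - \pi(n^2) \to \infty$ as $n \to \infty$.
   Context: $\pi(x)$ denotes the prime-counting function, i.e. the number of primes $p \leq x$. $\lfloor x \rfloor$ is the floor function, and $a \bmod b$ denotes the remainder of $a$ on division by $b$, so $0 \leq a \bmod b < b$. Natural numbers are positive integers. Legendre's conjecture is the assertion that there is always a prime between $n^2$ and $(n+1)^2$, that is, $\pi((n+1)^2) - \pi(n^2) \geq 1$ for every natural number $n$. For natural numbers $M_1, M_2, n$, the integer $\phi_T(M_1, M_2, \pi(n))$ is defined by $$\phi_T(M_1, M_2, \pi(n)) := \sum_{p_i \leq n} \left\lfloor \frac{M_1 \bmod p_i + M_2 \bmod p_i}{p_i} \right\rfloor - \sum_{p_i < p_j \leq n} \left\lfloor \frac{M_1 \bmod p_i p_j + M_2 \bmod p_i p_j}{p_i p_j} \right\rfloor + \sum_{p_i < p_j < p_k \leq n} \left\lfloor \frac{M_1 \bmod p_i p_j p_k +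 M_2 \bmod p_i p_j p_k}{p_i p_j p_k} \right\rfloor - \cdots,$$ where $p_i, p_j, p_k, \dots$ range over the primes less than or equal to $n$. Here $M \bmod p_i p_j$ means $M \bmod (p_i p_j)$, and similarly for longer products. Equivalently, writing $\beta_S = \prod_{p \in S} p$, $$\phi_T(M_1, M_2, \pi(n)) = \sum_{\emptyset \neq S} (-1)^{|S|+1} \left\lfloor \frac{(M_1 \bmod \beta_S) + (M_2 \bmod \beta_S)}{\beta_S} \right\rfloor,$$ where $S$ runs over all nonempty subsets of the set of primes $\leq n$ (an empty sum, as for $n = 1$, is $0$). *)

theory Defs
  imports Complex_Main "HOL-Computational_Algebra.Primes"
begin

definition primes_upto :: "nat \<Rightarrow> nat set" where
  "primes_upto n = {p. prime p \<and> p \<le> n}"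

definition prime_pi :: "nat \<Rightarrow> nat" where
  "prime_pi n = card (primes_upto n)"

definition legendre_conjecture :: bool where
  "legendre_conjecture \<longleftrightarrow>
     (\<forall>n::nat. n \<ge> 1 \<longrightarrow> int (prime_pi ((n + 1)\<^sup>2)) - int (prime_pi (n\<^sup>2)) \<ge> 1)"

(* phi_T M1 M2 n stands for phi_T(M1, M2, pi(n)): the last argument is the bound n on the
   primes, not their number pi(n). The index set S is a nonempty set of distinct primes <= n,
   so that the terms with card S = 1, 2, 3, ... are the successive alternating sums over
   p_i, over p_i < p_j, over p_i < p_j < p_k, etc. *)
definition phi_T :: "nat \<Rightarrow> nat \<Rightarrow> nat \<Rightarrow> int" where
  "phi_T M1 M2 n =
     (\<Sum>S | S \<subseteq> primes_upto n \<and> S \<noteq> {}.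
        (-1) ^ (card S + 1) * int ((M1 mod \<Prod>S + M2 mod \<Prod>S) div \<Prod>S))"

end

theory Submission
  imports Defs "HOL-Real_Asymp.Real_Asymp"
begin

text \<open>
  The three statements all follow from the identity
  $$\pi((n+1)^2) - \pi(n^2) = \pi(2n) - \pi(n) + 1 - \phi_T(n^2, 2n, \pi(n)),$$
  which is \<open>prime_gap_eq\<close>. By Legendre's sieve (\<open>legendre_sieve\<close>), the number of integers in
  $[1, x]$ without prime factors up to $n$ is an alternating sum of terms
  $\lfloor x / \beta \rfloor$. Every floor in the definition of $\phi_T(M_1, M_2, \pi(n))$ is the
  carry that makes $x \mapsto \lfloor x/\beta \rfloor$ fail to be additive at $M_1 + M_2$, so
  $\phi_T$ measures by how much the sieve count fails to be additive (\<open>phi_T_eq_rough_count\<close>). For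
  $n \<le> x < (n+1)^2$ the sieve count is $1 + \pi(x) - \pi(n)$, and this applies to $n^2$, to $2n$
  and to their sum $(n+1)^2 - 1$.

  With the identity, the first statement is a rearrangement. The second one is Bertrand's postulate
  (\<open>bertrand\<close>), and the third one asks for $\pi(2n) - \pi(n) \to \infty$
  (\<open>primes_doubling_tendsto_at_top\<close>). Both come from Erdos's analysis of $\binom{2n}{n}$, made
  quantitative: writing $k = \pi(2n) - \pi(n)$, the factorisation of $\binom{2n}{n}$ yields
  $$\tfrac{n}{3} \ln 4 \<le> (\sqrt{2n} + k) \ln (2n)$$
  (\<open>primes_doubling_bound\<close>). The left-hand side outgrows $\sqrt{2n} \ln (2n)$, so $k$ tends to
  infinity, and $k = 0$ is already impossible for $n \<ge> 512$.
\<close>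

section \<open>Counting integers free of given prime factors\<close>

lemma finite_primes_upto [simp]: "finite (primes_upto n)"
  by (simp add: primes_upto_def)

definition rough_count :: "nat set \<Rightarrow> nat \<Rightarrow> nat" where
  "rough_count P x = card {m \<in> {1..x}. \<forall>p\<in>P. \<not> p dvd m}"

text \<open>
  Among the integers in $[1, x]$ free of prime factors in $P$, those divisible by the new prime $q$
  are exactly the $q k$ with $k \<le> x / q$ and $k$ again free of prime factors in $P$.
\<close>

lemma rough_count_insert:
  assumes q: "prime q" "q \<notin> P" and P: "\<And>p. p \<in> P \<Longrightarrow> prime p"
  shows "rough_count P x = rough_count (insert q P) x + rough_count P (x div q)"
proof -
  let ?R = "\<lambda>P x. {m \<in> {1..x}. \<forall>p\<in>P. \<not> p dvd m}"
  have q0: "q > 0" using q prime_gt_0_nat by blast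
  have dvd_mult_q: "p dvd q * m \<longleftrightarrow> p dvd m" if "p \<in> P" for p m
    using that P[OF that] q by (metis dvd_mult prime_dvd_mult_iff primes_dvd_imp_eq)
  have "?R P x = ?R (insert q P) x \<union> (\<lambda>m. q * m) ` ?R P (x div q)"
  proof (intro set_eqI iffI)
    fix m assume m: "m \<in> ?R P x"
    show "m \<in> ?R (insert q P) x \<union> (\<lambda>m. q * m) ` ?R P (x div q)"
    proof (cases "q dvd m")
      case True
      then obtain k where k: "m = q * k" by blast
      have "k \<in> ?R P (x div q)"
        using m k q0 dvd_mult_q by (auto simp: less_eq_div_iff_mult_less_eq mult.commute)
      with k show ?thesis by blast
    qed (use m in auto)
  next
    fix m assume "m \<in> ?R (insert q P) x \<union> (\<lambda>m. q * m) ` ?R P (x div q)"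
    thus "m \<in> ?R P x"
      using q0 dvd_mult_q by (auto simp: less_eq_div_iff_mult_less_eq mult.commute)
  qed
  moreover have "card (?R (insert q P) x \<union> (\<lambda>m. q * m) ` ?R P (x div q))
      = card (?R (insert q P) x) + card ((\<lambda>m. q * m) ` ?R P (x div q))"
    by (rule card_Un_disjoint) auto
  moreover have "card ((\<lambda>m. q * m) ` ?R P (x div q)) = card (?R P (x div q))"
    using q0 by (intro card_image inj_onI) auto
  ultimately show ?thesis by (simp add: rough_count_def)
qed

text \<open>
  Inclusion--exclusion, obtained by adding one prime at a time: the subsets of $P \<union> \{q\}$ that
  contain $q$ carry the opposite sign, and $\lfloor x / (q \beta) \rfloor = \lfloor \lfloor x / q
  \rfloor / \beta \rfloor$, so they sum to minus the sieve for $P$ at $x / q$.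
\<close>

lemma legendre_sieve:
  assumes "finite P" and "\<And>p. p \<in> P \<Longrightarrow> prime p"
  shows "int (rough_count P x) = (\<Sum>S\<in>Pow P. (-1) ^ card S * int (x div \<Prod>S))"
  using assms
proof (induction P arbitrary: x rule: finite_induct)
  case empty
  have "{m \<in> {1..x}. \<forall>p\<in>{}. \<not> p dvd m} = {1..x}" by auto
  thus ?case by (simp add: rough_count_def)
next
  case (insert q P)
  have card_prod: "card (insert q S) = Suc (card S)" "\<Prod>(insert q S) = q * \<Prod>S" if "S \<in> Pow P" for S
  proof -
    have "q \<notin> S" "finite S" using that insert.hyps finite_subset[of S P] by auto
    thus "card (insert q S) = Suc (card S)" "\<Prod>(insert q S) = q * \<Prod>S" by simp_all
  qed
  have "(\<Sum>S\<in>Pow (insert q P). (-1) ^ card S * int (x div \<Prod>S)) =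
      (\<Sum>S\<in>Pow P. (-1) ^ card S * int (x div \<Prod>S)) +
      (\<Sum>S\<in>insert q ` Pow P. (-1) ^ card S * int (x div \<Prod>S))"
    unfolding Pow_insert using insert.hyps by (intro sum.union_disjoint) auto
  also have "(\<Sum>S\<in>insert q ` Pow P. (-1) ^ card S * int (x div \<Prod>S)) =
      (\<Sum>S\<in>Pow P. (-1) ^ card (insert q S) * int (x div \<Prod>(insert q S)))"
    using insert.hyps by (subst sum.reindex) (auto intro!: inj_onI)
  also have "\<dots> = (\<Sum>S\<in>Pow P. - ((-1) ^ card S * int (x div q div \<Prod>S)))"
    by (intro sum.cong refl, subst card_prod, assumption, subst card_prod, assumption)
       (simp add: div_mult2_eq)
  also have "\<dots> = - int (rough_count P (x div q))"
    using insert by (simp add: sum_negf)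
  also have "(\<Sum>S\<in>Pow P. (-1) ^ card S * int (x div \<Prod>S)) = int (rough_count P x)"
    using insert by simp
  finally show ?case
    using rough_count_insert[of q P x] insert by simp
qed

text \<open>
  The floor in each term is the carry in the addition of $M_1$ and $M_2$ modulo $\beta$, that is
  $\lfloor (M_1 + M_2)/\beta \rfloor - \lfloor M_1/\beta \rfloor - \lfloor M_2/\beta \rfloor$.
  Hence the sum is the defect of additivity of the sieve.
\<close>

lemma phi_T_eq_rough_count:
  "phi_T M1 M2 n = int (rough_count (primes_upto n) M1) + int (rough_count (primes_upto n) M2)
     - int (rough_count (primes_upto n) (M1 + M2))"
proof -
  let ?P = "primes_upto n"
  let ?carry = "\<lambda>S. (M1 mod \<Prod>S + M2 mod \<Prod>S) div \<Prod>S"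
  have sieve: "int (rough_count ?P x) = (\<Sum>S\<in>Pow ?P. (-1) ^ card S * int (x div \<Prod>S))" for x
    by (rule legendre_sieve) (auto simp: primes_upto_def)
  \<comment> \<open>The empty set may be included: its product is 1, and there is no carry modulo 1.\<close>
  have "phi_T M1 M2 n = (\<Sum>S\<in>Pow ?P. (-1) ^ (card S + 1) * int (?carry S))"
    unfolding phi_T_def by (rule sum.mono_neutral_left) auto
  also have "\<dots> = (\<Sum>S\<in>Pow ?P. (-1) ^ card S * int (M1 div \<Prod>S)
      + (-1) ^ card S * int (M2 div \<Prod>S) - (-1) ^ card S * int ((M1 + M2) div \<Prod>S))"
    by (intro sum.cong refl) (simp add: div_add1_eq[of M1 M2] algebra_simps)
  finally show ?thesis by (simp add: sieve sum.distrib sum_subtractf)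
qed

section \<open>The gap between consecutive squares\<close>

text \<open>
  Below $(n+1)^2$ there is no room for two prime factors that both exceed $n$.
\<close>

lemma rough_imp_prime:
  fixes m :: nat
  assumes "m > 1" "m < (n + 1)\<^sup>2" and rough: "\<And>p. prime p \<Longrightarrow> p \<le> n \<Longrightarrow> \<not> p dvd m"
  shows "prime m"
proof -
  obtain p k where p: "prime p" "m = p * k"
    using prime_factor_nat[of m] assms(1) by (auto elim: dvdE)
  have "p \<ge> n + 1" using rough[of p] p by force
  have "k = 1"
  proof (rule ccontr)
    assume "k \<noteq> 1"
    then obtain r where r: "prime r" "r dvd k" using prime_factor_nat by blast
    have "r \<ge> n + 1" using rough[of r] r p by force
    moreover have "r \<le> k" using r assms(1) p by (intro dvd_imp_le) (auto intro: Nat.gr0I)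
    ultimately have "(n + 1) * (n + 1) \<le> p * k" using \<open>p \<ge> n + 1\<close> by (intro mult_mono) auto
    thus False using assms(2) p by (simp add: power2_eq_square)
  qed
  thus ?thesis using p by simp
qed

lemma card_primes_between:
  assumes "n \<le> x"
  shows "card {p. prime p \<and> n < p \<and> p \<le> x} + prime_pi n = prime_pi x"
proof -
  have "primes_upto x = {p. prime p \<and> n < p \<and> p \<le> x} \<union> primes_upto n"
    using assms by (auto simp: primes_upto_def)
  thus ?thesis unfolding prime_pi_def
    by (simp, subst card_Un_disjoint) (auto simp: primes_upto_def)
qed

lemma rough_count_primes_upto:
  assumes "1 \<le> n" "n \<le> x" "x < (n + 1)\<^sup>2"
  shows "int (rough_count (primes_upto n) x) = 1 + int (prime_pi x) - int (prime_pi n)"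
proof -
  have "{m \<in> {1..x}. \<forall>p\<in>primes_upto n. \<not> p dvd m} = insert 1 {p. prime p \<and> n < p \<and> p \<le> x}"
  proof (intro set_eqI iffI)
    fix m assume m: "m \<in> {m \<in> {1..x}. \<forall>p\<in>primes_upto n. \<not> p dvd m}"
    show "m \<in> insert 1 {p. prime p \<and> n < p \<and> p \<le> x}"
    proof (cases "m = 1")
      case False
      have "prime m"
        using m False assms by (intro rough_imp_prime[of m n]) (auto simp: primes_upto_def)
      thus ?thesis using m by (auto simp: primes_upto_def not_le[symmetric])
    qed simp
  next
    fix m assume "m \<in> insert 1 {p. prime p \<and> n < p \<and> p \<le> x}"
    thus "m \<in> {m \<in> {1..x}. \<forall>p\<in>primes_upto n. \<not> p dvd m}"
      using assms by (auto simp: primes_upto_def dest: primes_dvd_imp_eq prime_gt_0_nat)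
  qed
  thus ?thesis
    using card_primes_between[OF assms(2)] by (simp add: rough_count_def)
qed

text \<open>
  The sieve by the primes up to $n$ counts primes exactly (apart from the number 1) at each of the
  three arguments $n^2$, $2n$ and $n^2 + 2n$, since all of them lie below $(n+1)^2$. The last one
  reaches up to $(n+1)^2 - 1$, and $(n+1)^2$ itself is not a prime.
\<close>

theorem prime_gap_eq:
  assumes "n \<ge> 1"
  shows "int (prime_pi ((n + 1)\<^sup>2)) - int (prime_pi (n\<^sup>2)) =
           int (prime_pi (2 * n)) - int (prime_pi n) + 1 - phi_T (n\<^sup>2) (2 * n) n"
proof -
  have "n\<^sup>2 + 2 * n < (n + 1)\<^sup>2" "n \<le> n\<^sup>2" by (auto simp: power2_eq_square)
  moreover have "primes_upto ((n + 1)\<^sup>2) = primes_upto (n\<^sup>2 + 2 * n)"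
  proof -
    have "(n + 1)\<^sup>2 = Suc (n\<^sup>2 + 2 * n)" by (simp add: power2_eq_square)
    moreover have "\<not> prime ((n + 1)\<^sup>2)" by (simp add: prime_power_iff)
    ultimately show ?thesis by (auto simp: primes_upto_def le_Suc_eq)
  qed
  ultimately show ?thesis
    using assms by (simp add: phi_T_eq_rough_count rough_count_primes_upto prime_pi_def)
qed

section \<open>Chebyshev's bound for the product of primes\<close>

lemma prod_primes_dvd:
  fixes N :: nat
  assumes "finite P" "\<And>p. p \<in> P \<Longrightarrow> prime p" "\<And>p. p \<in> P \<Longrightarrow> p dvd N"
  shows "\<Prod>P dvd N"
  using assms
proof (induction P rule: finite_induct)
  case (insert p P)
  have "coprime p (\<Prod>P)"
    using insert by (intro prod_coprime_right) (metis insertCI primes_coprime)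
  thus ?case using insert by (simp add: divides_mult)
qed simp

text \<open>
  Strong induction. For odd $n = 2m + 1$ the primes in $(m + 1, n]$ all divide $\binom{2m+1}{m}$,
  which is at most $4^m$ because it occurs twice in the row sum $2^{2m+1}$; the primes up to $m + 1$
  contribute at most $4^{m+1}$ by induction. An even $n > 2$ adds no prime to those up to $n - 1$.
\<close>

lemma prod_primes_upto_le: "\<Prod>(primes_upto n) \<le> 4 ^ n"
proof (induction n rule: less_induct)
  case (less n)
  consider "n < 2" | "n = 2" | "n > 2" "even n" | m where "n = 2 * m + 1" "m \<ge> 1"
    by (cases "n < 2"; cases "n = 2"; cases "even n") (auto elim!: oddE)
  thus ?case
  proof cases
    case 1
    hence "primes_upto n = {}" by (auto simp: primes_upto_def dest: prime_ge_2_nat)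
    thus ?thesis by simp
  next
    case 2
    have "primes_upto n = {2}" using 2
      by (auto simp: primes_upto_def dest: prime_ge_2_nat)
    thus ?thesis using 2 by simp
  next
    case 3
    have "\<not> prime n" using 3 prime_odd_nat by blast
    hence "primes_upto n = primes_upto (n - 1)" using 3
      by (auto simp: primes_upto_def le_less)
    hence "\<Prod>(primes_upto n) \<le> 4 ^ (n - 1)" using less.IH[of "n - 1"] 3 by simp
    also have "\<dots> \<le> 4 ^ n" by (intro power_increasing) auto
    finally show ?thesis .
  next
    case 4
    let ?Q = "{p. prime p \<and> m + 1 < p \<and> p \<le> n}"
    let ?C = "(2 * m + 1) choose m"
    have fact_eq: "fact m * fact (m + 1) * ?C = (fact n :: nat)"
      using binomial_fact_lemma[of m "2 * m + 1"] 4 by (simp add: mult_ac)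
    have "p dvd ?C" if "p \<in> ?Q" for p
    proof -
      have "p dvd fact m * fact (m + 1) * ?C"
        unfolding fact_eq using that by (simp add: prime_dvd_fact_iff)
      thus ?thesis using that by (auto simp: prime_dvd_mult_iff prime_dvd_fact_iff
            simp del: fact_Suc binomial_Suc_Suc)
    qed
    hence "\<Prod>?Q dvd ?C" by (intro prod_primes_dvd) auto
    hence "\<Prod>?Q \<le> ?C" by (intro dvd_imp_le) (auto simp del: binomial_Suc_Suc)
    also have "?C \<le> 4 ^ m"
    proof -
      have "2 * ?C = (\<Sum>k\<in>{m, m + 1}. (2 * m + 1) choose k)"
        using binomial_symmetric[of m "2 * m + 1"] by (simp del: binomial_Suc_Suc)
      also have "\<dots> \<le> (\<Sum>k\<le>2 * m + 1. (2 * m + 1) choose k)"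
        by (intro sum_mono2) auto
      also have "\<dots> = 2 * 4 ^ m" by (simp only: choose_row_sum) (simp add: power_mult)
      finally show ?thesis by simp
    qed
    finally have Q: "\<Prod>?Q \<le> 4 ^ m" .
    have "primes_upto n = primes_upto (m + 1) \<union> ?Q" using 4 by (auto simp: primes_upto_def)
    hence "\<Prod>(primes_upto n) = \<Prod>(primes_upto (m + 1)) * \<Prod>?Q"
      by (simp, subst prod.union_disjoint) (auto simp: primes_upto_def)
    also have "\<dots> \<le> 4 ^ (m + 1) * 4 ^ m"
      using less.IH[of "m + 1"] 4 Q by (intro mult_mono) auto
    also have "\<dots> = 4 ^ n" using 4 by (simp add: power_add[symmetric] mult_2)
    finally show ?thesis .
  qed
qed

section \<open>Prime powers in the central binomial coefficient\<close>

text \<open>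
  Legendre's formula. The infinite sum over $i$ is cut off at any $N$ beyond which all terms vanish.
  In the induction, the sum grows by the number of $i$ with $p^i$ dividing the new factor, which is
  the multiplicity of $p$ in it.
\<close>

lemma multiplicity_fact:
  assumes "prime p" and "n < p ^ Suc N"
  shows "multiplicity p (fact n :: nat) = (\<Sum>i=1..N. n div p ^ i)"
  using assms(2)
proof (induction n)
  case (Suc n)
  have p: "p > 1" using assms(1) prime_gt_1_nat by blast
  have "multiplicity p (Suc n) = card {i \<in> {1..N}. p ^ i dvd Suc n}"
  proof -
    have iff: "p ^ i dvd Suc n \<longleftrightarrow> i \<le> multiplicity p (Suc n)" for i
      using p by (intro power_dvd_iff_le_multiplicity) auto
    have "p ^ multiplicity p (Suc n) < p ^ Suc N"
      using Suc.prems dvd_imp_le[OF multiplicity_dvd[of p "Suc n"]] by simp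
    hence "multiplicity p (Suc n) \<le> N"
      using p power_less_imp_less_exp less_Suc_eq_le by blast
    hence "{i \<in> {1..N}. p ^ i dvd Suc n} = {1..multiplicity p (Suc n)}"
      unfolding iff by auto
    thus ?thesis by simp
  qed
  also have "\<dots> = (\<Sum>i=1..N. if p ^ i dvd Suc n then 1 else 0)"
    by (simp add: sum.If_cases Int_def)
  also have "\<dots> + (\<Sum>i=1..N. n div p ^ i) = (\<Sum>i=1..N. Suc n div p ^ i)"
    unfolding sum.distrib[symmetric]
    by (intro sum.cong refl) (simp add: div_Suc dvd_eq_mod_eq_0)
  finally have step: "multiplicity p (Suc n) + (\<Sum>i=1..N. n div p ^ i) = (\<Sum>i=1..N. Suc n div p ^ i)" .
  have "multiplicity p (fact (Suc n) :: nat) = multiplicity p (Suc n * fact n)"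
    by (simp only: fact_Suc of_nat_id)
  also have "\<dots> = multiplicity p (Suc n) + multiplicity p (fact n :: nat)"
    using assms(1) by (intro prime_elem_multiplicity_mult_distrib) auto
  finally show ?case using Suc step by simp
qed simp

lemma double_div:
  fixes n d :: nat
  shows "2 * n div d = 2 * (n div d) + 2 * (n mod d) div d"
proof (cases "d = 0")
  case False
  have "2 * n = 2 * (n mod d) + 2 * (n div d) * d"
  proof -
    have "2 * n = 2 * (n div d * d + n mod d)" by (simp only: div_mult_mod_eq)
    thus ?thesis by (simp only: distrib_left mult.assoc add.commute)
  qed
  hence "2 * n div d = (2 * (n mod d) + 2 * (n div d) * d) div d" by simp
  also have "\<dots> = 2 * (n div d) + 2 * (n mod d) div d" using False by (rule div_mult_self1)
  finally show ?thesis .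
qed simp

lemma double_div_bounds:
  fixes n d :: nat
  shows "2 * (n div d) \<le> 2 * n div d" "2 * n div d \<le> 2 * (n div d) + 1"
proof -
  have "2 * (n mod d) div d < 2" if "d > 0"
    using that by (subst div_less_iff_less_mult) auto
  thus "2 * (n div d) \<le> 2 * n div d" "2 * n div d \<le> 2 * (n div d) + 1"
    by (cases "d = 0"; simp add: double_div[of n d])+
qed

lemma multiplicity_central_binomial:
  assumes "prime p" "2 * n < p ^ Suc N"
  shows "multiplicity p ((2 * n) choose n) = (\<Sum>i=1..N. 2 * n div p ^ i - 2 * (n div p ^ i))"
proof -
  have "fact n * fact n * ((2 * n) choose n) = (fact (2 * n) :: nat)"
    using binomial_fact_lemma[of n "2 * n"] by simp
  hence "multiplicity p (fact n * fact n * ((2 * n) choose n)) = multiplicity p (fact (2 * n) :: nat)"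
    by simp
  hence "2 * multiplicity p (fact n :: nat) + multiplicity p ((2 * n) choose n)
      = multiplicity p (fact (2 * n) :: nat)"
    using assms by (simp add: prime_elem_multiplicity_mult_distrib)
  hence "multiplicity p ((2 * n) choose n)
      = (\<Sum>i=1..N. 2 * n div p ^ i) - (\<Sum>i=1..N. 2 * (n div p ^ i))"
    using assms by (simp add: multiplicity_fact[where N = N] sum_distrib_left)
  also have "\<dots> = (\<Sum>i=1..N. 2 * n div p ^ i - 2 * (n div p ^ i))"
    by (rule sum_subtractf_nat[symmetric]) (rule double_div_bounds)
  finally show ?thesis .
qed

text \<open>
  Every term of the sum for the multiplicity is at most 1, and the terms with $p^i > 2n$ vanish, so
  the multiplicity is at most the largest $i$ with $p^i \<le> 2n$.
\<close>

lemma prime_power_central_binomial_le: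
  assumes "prime p" "n \<ge> 1"
  shows "p ^ multiplicity p ((2 * n) choose n) \<le> 2 * n"
proof (rule ccontr)
  define N where "N = multiplicity p ((2 * n) choose n)"
  assume "\<not> ?thesis"
  hence less: "2 * n < p ^ N" by (simp add: N_def)
  then obtain M where M: "N = Suc M" using assms by (cases N) auto
  have "N = (\<Sum>i=1..M. 2 * n div p ^ i - 2 * (n div p ^ i))"
    unfolding N_def using assms less M by (intro multiplicity_central_binomial) auto
  also have "\<dots> \<le> (\<Sum>i=1..M. 1)" using double_div_bounds(2) by (intro sum_mono) (simp add: le_diff_conv)
  also have "\<dots> = M" by simp
  finally show False using M by simp
qed

text \<open>
  For $2n/3 < p \<le> n$ the prime $p$ occurs twice in $(2n)!$, through $p$ and $2p$, and once in each
  of the two factors $n!$ of the denominator. The condition $n \<ge> 3$ forces $p \<ge> 3$ and so keeps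
  $p^2$ above $2n$.
\<close>

lemma multiplicity_central_binomial_eq_0:
  assumes "prime p" "p \<le> n" "2 * n < 3 * p" "n \<ge> 3"
  shows "multiplicity p ((2 * n) choose n) = 0"
proof -
  have "p \<ge> 3" using assms by linarith
  hence "3 * p \<le> p * p" by simp
  hence "2 * n < p * p" using assms by linarith
  hence "2 * n < p ^ Suc 1" by simp
  hence "multiplicity p ((2 * n) choose n) = 2 * n div p - 2 * (n div p)"
    using assms by (subst multiplicity_central_binomial[where N = 1]) auto
  moreover have "n div p = 1" "2 * n div p = 2"
    using assms by (auto intro!: div_nat_eqI)
  ultimately show ?thesis by simp
qed

lemma central_binomial_eq_prod:
  "(2 * n) choose n = (\<Prod>p\<in>primes_upto (2 * n). p ^ multiplicity p ((2 * n) choose n))"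
proof -
  let ?C = "(2 * n) choose n"
  have "?C = (\<Prod>p\<in>prime_factors ?C. p ^ multiplicity p ?C)"
    by (rule prime_factorization_nat) simp
  also have "\<dots> = (\<Prod>p\<in>primes_upto (2 * n). p ^ multiplicity p ?C)"
  proof (rule prod.mono_neutral_left)
    have dvd: "?C dvd fact (2 * n)"
      using binomial_fact_lemma[of n "2 * n"] by (metis dvd_triv_right le_add1 mult_2)
    show "prime_factors ?C \<subseteq> primes_upto (2 * n)"
    proof
      fix p assume "p \<in> prime_factors ?C"
      hence p: "prime p" "p dvd ?C" by auto
      hence "p dvd fact (2 * n)" using dvd dvd_trans by blast
      thus "p \<in> primes_upto (2 * n)" using p by (simp add: primes_upto_def prime_dvd_fact_iff)
    qed
  qed (auto simp: primes_upto_def prime_factors_multiplicity)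
  finally show ?thesis .
qed

section \<open>Primes between n and 2n\<close>

text \<open>
  The primes dividing $\binom{2n}{n}$ fall into three classes. Those with $p^2 \<le> 2n$ contribute at
  most $2n$ each. The other ones up to $2n/3$ occur at most once, since their prime power is at most
  $2n < p^2$; together they contribute at most the product of all primes up to $2n/3$. There are none
  in $(2n/3, n]$, and the ones in $(n, 2n]$ contribute at most $2n$ each.
\<close>

lemma central_binomial_le:
  assumes "n \<ge> 3"
  shows "(2 * n) choose n \<le>
    (2 * n) ^ card {p. prime p \<and> p\<^sup>2 \<le> 2 * n} * 4 ^ (2 * n div 3) * (2 * n) ^ (prime_pi (2 * n) - prime_pi n)"
proof -
  define f where "f p = p ^ multiplicity p ((2 * n) choose n)" for p
  define A where "A = {p. prime p \<and> p\<^sup>2 \<le> 2 * n}"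
  define B where "B = primes_upto (2 * n div 3) - A"
  define D where "D = {p. prime p \<and> n < p \<and> p \<le> 2 * n}"
  have AP: "A \<subseteq> primes_upto (2 * n)"
  proof
    fix p assume "p \<in> A"
    moreover have "p \<le> p\<^sup>2" by (simp add: power2_eq_square)
    ultimately show "p \<in> primes_upto (2 * n)" by (auto simp: A_def primes_upto_def)
  qed
  hence fin: "finite A" "finite B" "finite D"
    by (auto simp: B_def D_def finite_subset)
  have f_le: "f p \<le> 2 * n" if "prime p" for p
    unfolding f_def using that assms by (intro prime_power_central_binomial_le) auto
  have AD: "p \<notin> D" if "p \<in> A" for p
  proof
    assume "p \<in> D"
    hence "n * n < p * p" by (intro mult_strict_mono) (auto simp: D_def)
    moreover have "p * p \<le> 2 * n" using that by (simp add: A_def power2_eq_square)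
    ultimately have "n * n < 2 * n" by linarith
    thus False using assms by simp
  qed
  have "(2 * n) choose n = prod f (primes_upto (2 * n))"
    unfolding f_def by (rule central_binomial_eq_prod)
  also have "\<dots> = prod f (A \<union> B \<union> D)"
  proof (rule prod.mono_neutral_right)
    show "\<forall>p\<in>primes_upto (2 * n) - (A \<union> B \<union> D). f p = 1"
    proof
      fix p assume p: "p \<in> primes_upto (2 * n) - (A \<union> B \<union> D)"
      hence "prime p" "p \<le> n" "\<not> p \<le> 2 * n div 3"
        by (auto simp: A_def B_def D_def primes_upto_def)
      hence "multiplicity p ((2 * n) choose n) = 0"
        using assms by (intro multiplicity_central_binomial_eq_0) auto
      thus "f p = 1" by (simp add: f_def)
    qed
    show "A \<union> B \<union> D \<subseteq> primes_upto (2 * n)"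
      using AP by (auto simp: B_def D_def primes_upto_def)
  qed auto
  also have "\<dots> = prod f A * prod f B * prod f D"
  proof -
    have "A \<inter> B = {}" "(A \<union> B) \<inter> D = {}"
      using AD by (auto simp: B_def D_def primes_upto_def)
    thus ?thesis using fin by (simp add: prod.union_disjoint)
  qed
  also have "\<dots> \<le> (2 * n) ^ card A * 4 ^ (2 * n div 3) * (2 * n) ^ card D"
  proof (intro mult_mono)
    show "prod f A \<le> (2 * n) ^ card A" "prod f D \<le> (2 * n) ^ card D"
      using f_le assms by (intro prod_le_power; force simp: A_def D_def)+
    have "prod f B \<le> \<Prod>B"
    proof (intro prod_mono conjI)
      fix p assume p: "p \<in> B"
      hence pp: "prime p" "2 * n < p\<^sup>2" by (auto simp: B_def A_def primes_upto_def)
      have "p ^ multiplicity p ((2 * n) choose n) < p ^ 2"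
        using f_le[OF pp(1)] pp(2) by (simp add: f_def)
      hence "multiplicity p ((2 * n) choose n) < 2"
        using pp(1) prime_gt_1_nat power_less_imp_less_exp by blast
      hence "f p \<le> p ^ 1"
        unfolding f_def using pp(1) prime_gt_0_nat[of p] by (intro power_increasing) auto
      thus "f p \<le> p" by simp
    qed simp
    also have "\<Prod>B \<le> \<Prod>(primes_upto (2 * n div 3))"
      by (intro dvd_imp_le prod_dvd_prod_subset) (auto simp: B_def primes_upto_def prime_gt_0_nat intro!: prod_pos)
    also have "\<dots> \<le> 4 ^ (2 * n div 3)" by (rule prod_primes_upto_le)
    finally show "prod f B \<le> 4 ^ (2 * n div 3)" .
  qed auto
  also have "card D = prime_pi (2 * n) - prime_pi n"
    using card_primes_between[of n "2 * n"] by (simp add: D_def)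
  finally show ?thesis by (simp add: A_def)
qed

text \<open>
  Logarithms of the upper bound for $\binom{2n}{n}$ against the lower bound $4^n / (2n)$. The extra
  factor $2n$ is absorbed because 1 is not a prime: at most $\lfloor \sqrt{2n} \rfloor - 1$ primes
  have a square up to $2n$.
\<close>

lemma primes_doubling_bound:
  assumes "n \<ge> 3"
  shows "real n * ln 4 / 3 \<le> (sqrt (2 * real n) + real (prime_pi (2 * n) - prime_pi n)) * ln (2 * real n)"
proof -
  let ?k = "prime_pi (2 * n) - prime_pi n"
  let ?A = "{p. prime p \<and> p\<^sup>2 \<le> 2 * n}"
  define s where "s = nat \<lfloor>sqrt (2 * real n)\<rfloor>"
  have n: "real n \<ge> 3" using assms by simp
  have "sqrt (2 * real n) \<ge> 1" using n by simp
  hence s: "real s \<le> sqrt (2 * real n)" "s \<ge> 1" by (auto simp: s_def le_nat_floor)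
  have "?A \<subseteq> {2..s}"
  proof
    fix p assume p: "p \<in> ?A"
    hence "real (p\<^sup>2) \<le> real (2 * n)" by (subst of_nat_le_iff) auto
    hence "real p \<le> sqrt (2 * real n)" by (intro real_le_rsqrt) auto
    thus "p \<in> {2..s}" using p prime_ge_2_nat by (auto simp: s_def le_nat_floor)
  qed
  hence "card ?A \<le> card {2..s}" by (rule card_mono[rotated]) simp
  hence card: "card ?A + 1 \<le> s" using s by simp
  have "4 ^ n / (2 * real n) \<le> real ((2 * n) choose n)"
    using assms by (intro central_binomial_lower_bound) auto
  also have "\<dots> \<le> real ((2 * n) ^ card ?A * 4 ^ (2 * n div 3) * (2 * n) ^ ?k)"
    using central_binomial_le[OF assms] by (subst of_nat_le_iff)
  finally have "4 ^ n \<le> (2 * real n) ^ (card ?A + 1 + ?k) * 4 ^ (2 * n div 3)"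
    using n by (simp add: field_simps power_add)
  also have "\<dots> \<le> (2 * real n) ^ (s + ?k) * 4 ^ (2 * n div 3)"
    using n card by (intro mult_right_mono power_increasing) auto
  finally have "ln (4 ^ n) \<le> ln ((2 * real n) ^ (s + ?k) * 4 ^ (2 * n div 3))"
    using n by (subst ln_le_cancel_iff) auto
  hence "real n * ln 4 \<le> real (s + ?k) * ln (2 * real n) + real (2 * n div 3) * ln 4"
    using n by (simp add: ln_mult_pos ln_realpow algebra_simps)
  also have "real (2 * n div 3) * ln 4 \<le> (2 * real n / 3) * ln 4"
    using of_nat_div_le_of_nat[of "2 * n" 3, where ?'a = real] by (intro mult_right_mono) auto
  finally have "real n * ln 4 / 3 \<le> real (s + ?k) * ln (2 * real n)" by simp
  also have "\<dots> \<le> (sqrt (2 * real n) + real ?k) * ln (2 * real n)"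
    using s n by (intro mult_right_mono) auto
  finally show ?thesis .
qed

lemma primes_doubling_tendsto_at_top:
  "filterlim (\<lambda>n. real (prime_pi (2 * n) - prime_pi n)) at_top sequentially"
proof (rule filterlim_at_top_mono)
  show "filterlim (\<lambda>n. real n * ln 4 / 3 / ln (2 * real n) - sqrt (2 * real n)) at_top sequentially"
    by real_asymp
  show "\<forall>\<^sub>F n in sequentially. real n * ln 4 / 3 / ln (2 * real n) - sqrt (2 * real n)
      \<le> real (prime_pi (2 * n) - prime_pi n)"
    using eventually_ge_at_top[of 3]
  proof eventually_elim
    case (elim n)
    hence "ln (2 * real n) > 0" by simp
    thus ?case using primes_doubling_bound[OF elim] by (simp add: field_simps)
  qed
qed

text \<open>
  With $x = \sqrt{2n}$ this contradicts the absence of primes in $(n, 2n]$. The tangent to the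
  logarithm at 32 suffices, since there $6 \ln x = 30 \ln 2$ and the slope $6/32$ is below $\ln 2$.
\<close>

lemma ln_less_of_ge_32:
  assumes "x \<ge> (32::real)"
  shows "6 * ln x < x * ln 2"
proof -
  have "ln x = ln 32 + ln (x / 32)" using assms by (simp add: ln_div)
  also have "ln (32::real) = 5 * ln 2" using ln_realpow[of 2 5] by simp
  also have "ln (x / 32) \<le> x / 32 - 1" using assms by (intro ln_le_minus_one) auto
  finally have "6 * ln x \<le> 30 * ln 2 + 6 * (x - 32) / 32" by (simp add: field_simps)
  also have "6 * (x - 32) / 32 \<le> (x - 32) * ln 2"
  proof -
    have "ln 2 \<ge> (1/2::real)" using ln_2_less_1 ln_le_minus_one[of "1/2::real"] by (simp add: ln_div)
    hence "(x - 32) * (1/2) \<le> (x - 32) * ln 2" using assms by (intro mult_left_mono) auto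
    thus ?thesis using assms by simp
  qed
  also have "30 * ln 2 + (x - 32) * ln 2 < x * ln (2::real)" by (simp add: algebra_simps)
  finally show ?thesis by simp
qed

lemma prime_pi_less_doubleI:
  assumes "n < q" "q \<le> 2 * n" "prime q"
  shows "prime_pi n < prime_pi (2 * n)"
proof -
  have "card {p. prime p \<and> n < p \<and> p \<le> 2 * n} > 0"
    using assms by (subst card_gt_0_iff) auto
  thus ?thesis using card_primes_between[of n "2 * n"] by simp
qed

text \<open>
  Bertrand's postulate. For $n \<ge> 512$, that is $\sqrt{2n} \<ge> 32$, it follows from the bound
  above. Below that, it suffices to exhibit primes each of which is less than twice its predecessor.
\<close>

theorem bertrand:
  assumes "n \<ge> 1"
  shows "prime_pi n < prime_pi (2 * n)"
proof (cases "n < 512")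
  case True
  consider "1 \<le> n \<and> n < 2" | "2 \<le> n \<and> n < 3" | "3 \<le> n \<and> n < 5" | "5 \<le> n \<and> n < 7"
    | "7 \<le> n \<and> n < 13" | "13 \<le> n \<and> n < 23" | "23 \<le> n \<and> n < 43" | "43 \<le> n \<and> n < 83"
    | "83 \<le> n \<and> n < 163" | "163 \<le> n \<and> n < 317" | "317 \<le> n \<and> n < 631"
    using True assms by linarith
  thus ?thesis
  proof cases
    case 1
    thus ?thesis by (intro prime_pi_less_doubleI[of n 2]) auto
  next
    case 2
    thus ?thesis by (intro prime_pi_less_doubleI[of n 3]) auto
  next
    case 3
    thus ?thesis by (intro prime_pi_less_doubleI[of n 5]) auto
  next
    case 4
    thus ?thesis by (intro prime_pi_less_doubleI[of n 7]) auto
  next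
    case 5
    thus ?thesis by (intro prime_pi_less_doubleI[of n 13]) auto
  next
    case 6
    thus ?thesis by (intro prime_pi_less_doubleI[of n 23]) auto
  next
    case 7
    thus ?thesis by (intro prime_pi_less_doubleI[of n 43]) auto
  next
    case 8
    thus ?thesis by (intro prime_pi_less_doubleI[of n 83]) auto
  next
    case 9
    thus ?thesis by (intro prime_pi_less_doubleI[of n 163]) auto
  next
    case 10
    thus ?thesis by (intro prime_pi_less_doubleI[of n 317]) auto
  next
    case 11
    thus ?thesis by (intro prime_pi_less_doubleI[of n 631]) auto
  qed
next
  case False
  define x where "x = sqrt (2 * real n)"
  have n: "2 * real n = x\<^sup>2" by (simp add: x_def)
  have "sqrt (32\<^sup>2) \<le> x" unfolding x_def using False by (intro real_sqrt_le_mono) simp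
  hence x: "x \<ge> 32" by simp
  show ?thesis
  proof (rule ccontr)
    assume "\<not> ?thesis"
    hence "real n * ln 4 / 3 \<le> x * ln (x\<^sup>2)"
      using primes_doubling_bound[of n] False x by (simp add: n x_def[symmetric])
    also have "ln (x\<^sup>2) = 2 * ln x" using x by (simp add: ln_realpow)
    also have "real n * ln 4 / 3 = x * (x * ln 2) / 3"
      using n ln_realpow[of 2 2] by (simp add: power2_eq_square)
    finally have "x * (x * ln 2) \<le> x * (6 * ln x)" by simp
    hence "x * ln 2 \<le> 6 * ln x" using x by simp
    thus False using ln_less_of_ge_32[OF x] by simp
  qed
qed

section \<open>Legendre's conjecture in terms of the carry sum\<close>

theorem corollary1:
  shows "(legendre_conjecture \<longleftrightarrow>
           (\<forall>n::nat. n \<ge> 1 \<longrightarrow>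
              phi_T (n\<^sup>2) (2 * n) n \<le> int (prime_pi (2 * n)) - int (prime_pi n))) \<and>
         (\<forall>n::nat. n \<ge> 1 \<longrightarrow> phi_T (n\<^sup>2) (2 * n) n \<le> 1 \<longrightarrow>
           int (prime_pi ((n + 1)\<^sup>2)) - int (prime_pi (n\<^sup>2)) \<ge> 1) \<and>
         ((\<exists>C::real. \<forall>n::nat. n \<ge> 1 \<longrightarrow> of_int (phi_T (n\<^sup>2) (2 * n) n) \<le> C) \<longrightarrow>
           filterlim (\<lambda>n::nat. real (prime_pi ((n + 1)\<^sup>2)) - real (prime_pi (n\<^sup>2)))
             at_top sequentially)"
proof (intro conjI)
  let ?g = "\<lambda>n. int (prime_pi ((n + 1)\<^sup>2)) - int (prime_pi (n\<^sup>2))"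
  let ?d = "\<lambda>n. int (prime_pi (2 * n)) - int (prime_pi n)"
  let ?phi = "\<lambda>n. phi_T (n\<^sup>2) (2 * n) n"
  have gap: "?g n = ?d n + 1 - ?phi n" if "n \<ge> 1" for n
    using that by (rule prime_gap_eq)
  have "?g n \<ge> 1 \<longleftrightarrow> ?phi n \<le> ?d n" if "n \<ge> 1" for n
    using gap[OF that] by linarith
  thus "legendre_conjecture \<longleftrightarrow> (\<forall>n::nat. n \<ge> 1 \<longrightarrow> ?phi n \<le> ?d n)"
    unfolding legendre_conjecture_def by blast
  show "\<forall>n::nat. n \<ge> 1 \<longrightarrow> ?phi n \<le> 1 \<longrightarrow> ?g n \<ge> 1"
  proof (intro allI impI)
    fix n :: nat assume n: "n \<ge> 1" "?phi n \<le> 1"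
    show "?g n \<ge> 1" using gap[OF n(1)] bertrand[OF n(1)] n(2) by linarith
  qed
  show "(\<exists>C::real. \<forall>n::nat. n \<ge> 1 \<longrightarrow> of_int (?phi n) \<le> C) \<longrightarrow>
      filterlim (\<lambda>n::nat. real (prime_pi ((n + 1)\<^sup>2)) - real (prime_pi (n\<^sup>2))) at_top sequentially"
  proof
    assume "\<exists>C::real. \<forall>n::nat. n \<ge> 1 \<longrightarrow> of_int (?phi n) \<le> C"
    then obtain C :: real where C: "\<And>n. n \<ge> 1 \<Longrightarrow> of_int (?phi n) \<le> C" by blast
    show "filterlim (\<lambda>n::nat. real (prime_pi ((n + 1)\<^sup>2)) - real (prime_pi (n\<^sup>2))) at_top sequentially"
    proof (rule filterlim_at_top_mono)
      show "filterlim (\<lambda>n. (1 - C) + real (prime_pi (2 * n) - prime_pi n)) at_top sequentially"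
        by (rule filterlim_tendsto_add_at_top[OF tendsto_const primes_doubling_tendsto_at_top])
      show "\<forall>\<^sub>F n in sequentially. (1 - C) + real (prime_pi (2 * n) - prime_pi n)
          \<le> real (prime_pi ((n + 1)\<^sup>2)) - real (prime_pi (n\<^sup>2))"
        using eventually_ge_at_top[of 1]
      proof eventually_elim
        case (elim n)
        have "real_of_int (?g n) = real_of_int (?d n + 1 - ?phi n)"
          using gap[OF elim] by (rule arg_cong)
        thus ?case using C[OF elim] bertrand[OF elim] by (simp add: of_nat_diff)
      qed
    qed
  qed
qed

end
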